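(* Let $X$ be a projective K3 surface over $\mathbb{C}$. Then linear degenerations (to standard cusps of $\overline{KM}(X)$) are geodesics in the Kähler moduli space $KM(X)$.
   Context: **Mukai lattice and period domain.** $N=N(X)=H^0(X,\mathbb{Z})\oplus NS(X)\oplus H^4(X,\mathbb{Z})$ with the Mukai pairing $(r,l,s).(r',l',s')=l.l'-rs'-r's$; signature $(2,\rho)$. $\tilde H(X,\mathbb{Z})=H^0\oplus H^2\oplus H^4$ carries the same pairing and the weight-two Hodge structure with $\tilde H^{2,0}=H^{2,0}(X)$, $\tilde H^{0,2}=H^{0,2}(X)$, $\tilde H^{1,1}=H^{0,0}\oplus H^{1,1}\oplus H^{2,2}$. $\mathfrak{D}(N)=\{[z]\in\mathbb{P}(N_{\mathbb{C}})\mid z^2=0,\ z.\bar z>0\}$; $\mathfrak{D}^+(X)$ is the connected component containing the points $[(1,x+iy,\tfrac12(x+iy)^2)]$ with $x\in NS(X)_{\mathbb{R}}$, $y$ ample. **Kähler moduli space.** $\Gamma_X$ is the image in $O(N)$ of the group of Hodge isometries of $\tilde H(X,\mathbb{Z})$, $\Gamma_X^+\subset\Gamma_X$ the image of those preserving $\mathfrak{D}^+(X)$, and $KM(X)=\Gamma_X^+\setminus\mathfrak{D}^+(X)$ with Baily–Borel compactification $\overline{KM}(X)$. A vector $v\in N$ is *standard* if $v.v=0$ and $\gcd\{v.u\mid u\in N\}=1$; the corresponding zero-dimensional boundary component of $\overline{KM}(X)$ (attached to the $\Gamma_X^+$-orbit of $\mathbb{Z}v$) is the *standard cusp* $[v]$.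 **Tube model and linear degenerations.** For a primitive isotropic $w\in N$ put $L(w)=w^\perp/\mathbb{Z}w$, $A(w)_{\mathbb{R}}=\{z\in N_{\mathbb{R}}\mid z.w=-1\}/\mathbb{R}w$, $C(L(w))=\{y\in L(w)_{\mathbb{R}}\mid y^2>0\}$. The isomorphism $\exp_w:A(w)_{\mathbb{R}}\times C(L(w))\to\mathfrak{D}(N)$ sends $x+iy$ to $[z]$, where $z\in N_{\mathbb{C}}$ is the unique vector with $z^2=0$, $z.\bar z>0$, $z.w=-1$, $z\equiv x+iy$ modulo $\mathbb{C}w$. A path $\gamma(t)\in KM(X)$, $t\gg0$, is a *linear degeneration* to $[v]$ if it has a lift to $\mathfrak{D}^+(X)$ of the form $\alpha(t)=\exp_w(x_0+i\,t\,y_0)$ with $w\in\Gamma_X\cdot v$, $x_0\in A(w)_{\mathbb{R}}$, $y_0\in C(L(w))$. **Metric.** $G=O(N_{\mathbb{R}})$ acts transitively on $\mathfrak{D}(N)$. For $[z]\in\mathfrak{D}(N)$ let $P=\langle\mathrm{Re}\,z,\mathrm{Im}\,z\rangle_{\mathbb{R}}$; the stabilizer is $K_P\cong SO(P)\times O(P^\perp)$ with Lie algebra $\mathfrak{k}_P$. Let $B(S,T)=\rho\cdot\mathrm{Tr}(S\circ T)$ be the Killing form of $\mathfrak{g}=\mathrm{Lie}(G)$ and $\mathfrak{m}_P=\mathfrak{k}_P^\perp=\{S\in\mathfrak{g}\mid S(P)\subset P^\perp,\ S(P^\perp)\subset P\}$. The restriction of $B$ to $\mathfrak{m}_P\cong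 T_{[z]}\mathfrak{D}(N)$ is positive definite and defines a $G$-invariant Riemannian metric on $\mathfrak{D}(N)$. Geodesics in the quotient $KM(X)$ are by definition images of geodesics in $\mathfrak{D}^+(X)$. Here a path is called a geodesic without requiring its parametrization to have constant speed (i.e. up to reparametrization). *)

theory Defs
  imports "HOL-Analysis.Analysis"
begin

section \<open>Complexification of a real quadratic space\<close>

text \<open>An element $x + iy$ of $V \otimes \mathbb{C}$ is the pair \<open>(x, y)\<close>.\<close>

type_synonym 'v cx = "'v \<times> 'v"

definition cx_scale :: "complex \<Rightarrow> 'v::real_vector cx \<Rightarrow> 'v cx" where
  "cx_scale c z = (Re c *\<^sub>R fst z - Im c *\<^sub>R snd z, Re c *\<^sub>R snd z + Im c *\<^sub>R fst z)"

definition cx_conj :: "'v::real_vector cx \<Rightarrow> 'v cx" where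
  "cx_conj z = (fst z, - snd z)"

definition cx_bil :: "('v \<Rightarrow> 'v \<Rightarrow> real) \<Rightarrow> 'v::real_vector cx \<Rightarrow> 'v cx \<Rightarrow> complex" where
  "cx_bil b z u = Complex (b (fst z) (fst u) - b (snd z) (snd u))
                          (b (fst z) (snd u) + b (snd z) (fst u))"

definition cx_map :: "('u \<Rightarrow> 'v) \<Rightarrow> 'u cx \<Rightarrow> 'v cx" where
  "cx_map f = map_prod f f"

definition cline :: "'v::real_vector cx \<Rightarrow> 'v cx set" where
  "cline z = range (\<lambda>c. cx_scale c z)"

text \<open>The projective space of $V \otimes \mathbb{C}$, with the quotient topology; its points are
  the complex lines \<open>cline z\<close> with \<open>z \<noteq> 0\<close>.\<close>

definition proj_topology :: "'v::euclidean_space cx set topology" where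
  "proj_topology = topology (\<lambda>U. U \<subseteq> cline ` (- {0}) \<and> open {z. z \<noteq> 0 \<and> cline z \<in> U})"

lemma openin_proj_topology:
  "openin (proj_topology :: 'v::euclidean_space cx set topology) U \<longleftrightarrow>
     U \<subseteq> cline ` (- {0}) \<and> open {z. z \<noteq> 0 \<and> cline z \<in> U}"
proof -
  have "istopology (\<lambda>U :: 'v cx set set. U \<subseteq> cline ` (- {0}) \<and> open {z. z \<noteq> 0 \<and> cline z \<in> U})"
    unfolding istopology_def
  proof (intro conjI allI impI)
    fix S T :: "'v cx set set"
    assume S: "S \<subseteq> cline ` (- {0}) \<and> open {z. z \<noteq> 0 \<and> cline z \<in> S}"
      and T: "T \<subseteq> cline ` (- {0}) \<and> open {z. z \<noteq> 0 \<and> cline z \<in> T}"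
    show "S \<inter> T \<subseteq> cline ` (- {0})" using S by blast
    have "{z. z \<noteq> 0 \<and> cline z \<in> S \<inter> T}
        = {z. z \<noteq> 0 \<and> cline z \<in> S} \<inter> {z. z \<noteq> 0 \<and> cline z \<in> T}" by blast
    then show "open {z. z \<noteq> 0 \<and> cline z \<in> S \<inter> T}" using S T by (simp add: open_Int)
  next
    fix K :: "'v cx set set set"
    assume K: "\<forall>U\<in>K. U \<subseteq> cline ` (- {0}) \<and> open {z. z \<noteq> 0 \<and> cline z \<in> U}"
    show "\<Union>K \<subseteq> cline ` (- {0})" using K by blast
    have "{z. z \<noteq> 0 \<and> cline z \<in> \<Union>K} = (\<Union>U\<in>K. {z. z \<noteq> 0 \<and> cline z \<in> U})" by blast
    then show "open {z. z \<noteq> 0 \<and> cline z \<in> \<Union>K}" using K by (simp add: open_UN)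
  qed
  then show ?thesis by (simp add: proj_topology_def)
qed

definition has_signature ::
  "('v::euclidean_space \<Rightarrow> 'v \<Rightarrow> real) \<Rightarrow> nat \<Rightarrow> nat \<Rightarrow> bool" where
  "has_signature b p q \<longleftrightarrow>
     (\<exists>P Q. subspace P \<and> subspace Q \<and> dim P = p \<and> dim Q = q \<and> span (P \<union> Q) = UNIV \<and>
        (\<forall>x\<in>P. x \<noteq> 0 \<longrightarrow> 0 < b x x) \<and> (\<forall>y\<in>Q. y \<noteq> 0 \<longrightarrow> b y y < 0) \<and>
        (\<forall>x\<in>P. \<forall>y\<in>Q. b x y = 0))"


section \<open>The period domain of a quadratic space of signature $(2, \rho)$\<close>

text \<open>Since $z.\bar z$ is always real, its positivity is stated for the real part.\<close>

definition period_cone :: "('v::euclidean_space \<Rightarrow> 'v \<Rightarrow> real) \<Rightarrow> 'v cx set" where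
  "period_cone b = {z. cx_bil b z z = 0 \<and> 0 < Re (cx_bil b z (cx_conj z))}"

definition period_domain :: "('v::euclidean_space \<Rightarrow> 'v \<Rightarrow> real) \<Rightarrow> 'v cx set set" where
  "period_domain b = cline ` period_cone b"

text \<open>$\mathfrak{g} = \mathfrak{so}(V)$, the subspace $\mathfrak{m}_P$ for $P = \langle \mathrm{Re}\,z,
  \mathrm{Im}\,z\rangle$, and the Killing form $\rho \cdot \mathrm{Tr}(S \circ T)$ of
  $\mathfrak{so}(2,\rho)$, where $\rho = \dim V - 2$.\<close>

definition lie_so :: "('v::euclidean_space \<Rightarrow> 'v \<Rightarrow> real) \<Rightarrow> ('v \<Rightarrow> 'v) set" where
  "lie_so b = {S. linear S \<and> (\<forall>u v. b (S u) v + b u (S v) = 0)}"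

definition orth_compl :: "('v::euclidean_space \<Rightarrow> 'v \<Rightarrow> real) \<Rightarrow> 'v set \<Rightarrow> 'v set" where
  "orth_compl b P = {u. \<forall>p\<in>P. b u p = 0}"

definition pos_plane :: "'v::euclidean_space cx \<Rightarrow> 'v set" where
  "pos_plane z = span {fst z, snd z}"

definition lie_m :: "('v::euclidean_space \<Rightarrow> 'v \<Rightarrow> real) \<Rightarrow> 'v set \<Rightarrow> ('v \<Rightarrow> 'v) set" where
  "lie_m b P = {S \<in> lie_so b. S ` P \<subseteq> orth_compl b P \<and> S ` orth_compl b P \<subseteq> P}"

definition lin_trace :: "('v::euclidean_space \<Rightarrow> 'v) \<Rightarrow> real" where
  "lin_trace f = (\<Sum>e\<in>Basis. f e \<bullet> e)"

definition killing :: "('v::euclidean_space \<Rightarrow> 'v) \<Rightarrow> ('v \<Rightarrow> 'v) \<Rightarrow> real" where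
  "killing S T = (real DIM('v) - 2) * lin_trace (S \<circ> T)"

text \<open>Curves in the period domain are handled through lifts to the cone over it. The isomorphism
  $\mathfrak{m}_P \cong T_{[z]}\mathfrak{D}$ sends \<open>S\<close> to the derivative of $[\exp(sS)z]$ at
  $s = 0$, and $T_{[z]}\mathbb{P}(V_{\mathbb{C}}) = \mathrm{Hom}(\mathbb{C}z, V_{\mathbb{C}}/\mathbb{C}z)$;
  so the velocity of $[z(t)]$ is the unique \<open>S\<close> in $\mathfrak{m}_P$ with
  $S z(t) \equiv z'(t)$ modulo $\mathbb{C}z(t)$.\<close>

definition velocity ::
  "('v::euclidean_space \<Rightarrow> 'v \<Rightarrow> real) \<Rightarrow> (real \<Rightarrow> 'v cx) \<Rightarrow> real \<Rightarrow> ('v \<Rightarrow> 'v)" where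
  "velocity b z t = (THE S. S \<in> lie_m b (pos_plane (z t)) \<and>
      cx_map S (z t) - vector_derivative z (at t) \<in> cline (z t))"

definition riem_speed ::
  "('v::euclidean_space \<Rightarrow> 'v \<Rightarrow> real) \<Rightarrow> (real \<Rightarrow> 'v cx) \<Rightarrow> real \<Rightarrow> real" where
  "riem_speed b z t = sqrt (killing (velocity b z t) (velocity b z t))"

definition riem_length ::
  "('v::euclidean_space \<Rightarrow> 'v \<Rightarrow> real) \<Rightarrow> (real \<Rightarrow> 'v cx) \<Rightarrow> real \<Rightarrow> real \<Rightarrow> real" where
  "riem_length b z s u = integral {s..u} (riem_speed b z)"

definition C1_lift ::
  "('v::euclidean_space \<Rightarrow> 'v \<Rightarrow> real) \<Rightarrow> real set \<Rightarrow> (real \<Rightarrow> 'v cx set) \<Rightarrow> (real \<Rightarrow> 'v cx) \<Rightarrow> bool"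
  where
  "C1_lift b I \<delta> z \<longleftrightarrow>
     z C1_differentiable_on I \<and> (\<forall>t\<in>I. z t \<in> period_cone b \<and> \<delta> t = cline (z t))"

text \<open>Riemannian geodesics: non-constant curves of constant speed that are locally shortest.\<close>

definition affine_geodesic ::
  "('v::euclidean_space \<Rightarrow> 'v \<Rightarrow> real) \<Rightarrow> real set \<Rightarrow> (real \<Rightarrow> 'v cx set) \<Rightarrow> bool" where
  "affine_geodesic b J c \<longleftrightarrow> open J \<and> is_interval J \<and>
     (\<exists>z v. C1_lift b J c z \<and> 0 < v \<and> (\<forall>t\<in>J. riem_speed b z t = v) \<and>
        (\<forall>t\<in>J. \<exists>\<epsilon>>0. \<forall>s\<in>J. \<forall>u\<in>J. \<bar>s - t\<bar> < \<epsilon> \<and> \<bar>u - t\<bar> < \<epsilon> \<and> s \<le> u \<longrightarrow>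
           (\<forall>\<delta> y p q. p \<le> q \<and> C1_lift b {p..q} \<delta> y \<and> \<delta> p = c s \<and> \<delta> q = c u \<longrightarrow>
              riem_length b z s u \<le> riem_length b y p q)))"

definition geodesic_path ::
  "('v::euclidean_space \<Rightarrow> 'v \<Rightarrow> real) \<Rightarrow> real set \<Rightarrow> (real \<Rightarrow> 'v cx set) \<Rightarrow> bool" where
  "geodesic_path b I \<alpha> \<longleftrightarrow>
     (\<exists>J c \<phi>. affine_geodesic b J c \<and> \<phi> C1_differentiable_on I \<and> (\<forall>t\<in>I. 0 < deriv \<phi> t) \<and>
        \<phi> ` I = J \<and> (\<forall>t\<in>I. \<alpha> t = c (\<phi> t)))"


section \<open>The tube model\<close>

text \<open>Classes modulo $\mathbb{R}w$ are cosets. In \<open>exp_w\<close>, the condition $z \equiv x + iy$ modulo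
  $\mathbb{C}w$ says that the real and imaginary parts of \<open>z\<close> lie in the cosets \<open>x\<close> and \<open>y\<close>.\<close>

definition coset_of :: "'v::real_vector \<Rightarrow> 'v \<Rightarrow> 'v set" where
  "coset_of w x = range (\<lambda>a. x + a *\<^sub>R w)"

definition tube_A :: "('v::euclidean_space \<Rightarrow> 'v \<Rightarrow> real) \<Rightarrow> 'v \<Rightarrow> 'v set set" where
  "tube_A b w = {coset_of w x | x. b x w = -1}"

definition tube_C :: "('v::euclidean_space \<Rightarrow> 'v \<Rightarrow> real) \<Rightarrow> 'v \<Rightarrow> 'v set set" where
  "tube_C b w = {coset_of w y | y. b y w = 0 \<and> 0 < b y y}"

definition exp_w ::
  "('v::euclidean_space \<Rightarrow> 'v \<Rightarrow> real) \<Rightarrow> 'v \<Rightarrow> 'v set \<Rightarrow> 'v set \<Rightarrow> 'v cx set" where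
  "exp_w b w x y = cline (THE z. z \<in> period_cone b \<and> cx_bil b z (w, 0) = -1 \<and> fst z \<in> x \<and> snd z \<in> y)"


section \<open>Projective K3 surfaces\<close>

text \<open>A projective K3 surface enters through its cohomological data: a basis identifies
  $H^2(X,\mathbb{Z})$ with $\mathbb{Z}^{22}$ and $NS(X)$ with $\mathbb{Z}^{\rho}$, and the data are
  the intersection pairing on $H^2(X,\mathbb{R})$, the line $H^{2,0}(X)$ in $H^2(X,\mathbb{C})$,
  the ($\mathbb{R}$-linear extension of the) first Chern class
  $NS(X) \to H^2(X,\mathbb{Z})$, and the ample cone in $NS(X)_{\mathbb{R}}$.\<close>

record ('r::finite) K3 =
  ipair :: "real^22 \<Rightarrow> real^22 \<Rightarrow> real"
  H20 :: "(real^22) cx set"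
  chern :: "real^'r \<Rightarrow> real^22"
  ample :: "(real^'r) set"

definition int_vecs :: "(real^'n) set" where
  "int_vecs = {x. \<forall>i. x $ i \<in> \<int>}"

definition H02 :: "'r::finite K3 \<Rightarrow> (real^22) cx set" where
  "H02 X = cx_conj ` H20 X"

text \<open>The Hodge decomposition of $H^2$ of a surface is determined by $H^{2,0}$, as $H^{1,1}$ is the
  orthogonal complement of $H^{2,0} \oplus H^{0,2}$.\<close>

definition H11 :: "'r::finite K3 \<Rightarrow> (real^22) cx set" where
  "H11 X = {z. \<forall>u \<in> H20 X \<union> H02 X. cx_bil (ipair X) z u = 0}"

definition ns_pair :: "'r::finite K3 \<Rightarrow> real^'r \<Rightarrow> real^'r \<Rightarrow> real" where
  "ns_pair X l m = ipair X (chern X l) (chern X m)"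

text \<open>The conditions below are the ones satisfied by projective K3 surfaces: $H^2(X,\mathbb{Z})$ is
  an even unimodular lattice of signature $(3,19)$; $H^{2,0}(X)$ is spanned by a class with
  $\sigma^2 = 0$ and $\sigma.\bar\sigma > 0$; $NS(X) = H^{1,1}(X) \cap H^2(X,\mathbb{Z})$; and the
  ample cone is a chamber (in particular nonempty) for the $(-2)$-classes in $NS(X)$. Conversely,
  by the surjectivity of the period map, all such data arise from a projective K3 surface.\<close>

definition projective_K3 :: "'r::finite K3 \<Rightarrow> bool" where
  "projective_K3 X \<longleftrightarrow>
     bilinear (ipair X) \<and> (\<forall>x y. ipair X x y = ipair X y x) \<and>
     (\<forall>x\<in>int_vecs. \<forall>y\<in>int_vecs. ipair X x y \<in> \<int>) \<and>
     (\<forall>x\<in>int_vecs. ipair X x x / 2 \<in> \<int>) \<and>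
     \<bar>det (\<chi> i j. ipair X (axis i 1) (axis j 1))\<bar> = 1 \<and>
     has_signature (ipair X) 3 19 \<and>
     (\<exists>\<sigma>. H20 X = cline \<sigma> \<and> cx_bil (ipair X) \<sigma> \<sigma> = 0 \<and>
          0 < Re (cx_bil (ipair X) \<sigma> (cx_conj \<sigma>))) \<and>
     linear (chern X) \<and> inj (chern X) \<and>
     chern X ` int_vecs = {l \<in> int_vecs. (l, 0) \<in> H11 X} \<and>
     ample X \<in> components {y. 0 < ns_pair X y y \<and>
       (\<forall>d\<in>int_vecs. ns_pair X d d = -2 \<longrightarrow> ns_pair X y d \<noteq> 0)}"


section \<open>The Mukai lattice and the Kaehler moduli space\<close>

definition mukai :: "('l \<Rightarrow> 'l \<Rightarrow> real) \<Rightarrow> real \<times> 'l \<times> real \<Rightarrow> real \<times> 'l \<times> real \<Rightarrow> real" where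
  "mukai b u v = (case (u, v) of ((r, l, s), (r', l', s')) \<Rightarrow> b l l' - r * s' - r' * s)"

definition int_triples :: "(real \<times> (real^'n) \<times> real) set" where
  "int_triples = \<int> \<times> int_vecs \<times> \<int>"

type_synonym 'r NR = "real \<times> (real^'r) \<times> real"
type_synonym HR = "real \<times> (real^22) \<times> real"

abbreviation N_pair :: "'r::finite K3 \<Rightarrow> 'r NR \<Rightarrow> 'r NR \<Rightarrow> real" where
  "N_pair X \<equiv> mukai (ns_pair X)"

abbreviation H_pair :: "'r::finite K3 \<Rightarrow> HR \<Rightarrow> HR \<Rightarrow> real" where
  "H_pair X \<equiv> mukai (ipair X)"

definition N_incl :: "'r::finite K3 \<Rightarrow> 'r NR \<Rightarrow> HR" where
  "N_incl X u = (case u of (r, l, s) \<Rightarrow> (r, chern X l, s))"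

definition mukai_H20 :: "'r::finite K3 \<Rightarrow> HR cx set" where
  "mukai_H20 X = {((0, a, 0), (0, b, 0)) | a b. (a, b) \<in> H20 X}"

definition mukai_H02 :: "'r::finite K3 \<Rightarrow> HR cx set" where
  "mukai_H02 X = {((0, a, 0), (0, b, 0)) | a b. (a, b) \<in> H02 X}"

definition mukai_H11 :: "'r::finite K3 \<Rightarrow> HR cx set" where
  "mukai_H11 X = {((r, a, s), (r', b, s')) | r r' a b s s'. (a, b) \<in> H11 X}"

definition hodge_isometries :: "'r::finite K3 \<Rightarrow> (HR \<Rightarrow> HR) set" where
  "hodge_isometries X = {\<phi>. linear \<phi> \<and> \<phi> ` int_triples = int_triples \<and>
     (\<forall>u v. H_pair X (\<phi> u) (\<phi> v) = H_pair X u v) \<and>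
     cx_map \<phi> ` mukai_H20 X = mukai_H20 X \<and>
     cx_map \<phi> ` mukai_H11 X = mukai_H11 X \<and>
     cx_map \<phi> ` mukai_H02 X = mukai_H02 X}"

definition Gamma :: "'r::finite K3 \<Rightarrow> ('r NR \<Rightarrow> 'r NR) set" where
  "Gamma X = {g. \<exists>\<phi>\<in>hodge_isometries X. \<forall>u. N_incl X (g u) = \<phi> (N_incl X u)}"

text \<open>$[(1, x + iy, \frac12 (x + iy)^2)]$\<close>

definition exp_point :: "'r::finite K3 \<Rightarrow> real^'r \<Rightarrow> real^'r \<Rightarrow> 'r NR cx set" where
  "exp_point X x y = (let c = cx_bil (ns_pair X) (x, y) (x, y) / 2
                      in cline ((1, x, Re c), (0, y, Im c)))"

definition Dplus :: "'r::finite K3 \<Rightarrow> 'r NR cx set set" where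
  "Dplus X = {p. \<exists>x. \<exists>y\<in>ample X.
     connected_component_of (subtopology proj_topology (period_domain (N_pair X))) (exp_point X x y) p}"

definition act :: "('v \<Rightarrow> 'v) \<Rightarrow> 'v cx set \<Rightarrow> 'v cx set" where
  "act g p = cx_map g ` p"

definition Gamma_plus :: "'r::finite K3 \<Rightarrow> ('r NR \<Rightarrow> 'r NR) set" where
  "Gamma_plus X = {g \<in> Gamma X. act g ` Dplus X = Dplus X}"

definition KM_proj :: "'r::finite K3 \<Rightarrow> 'r NR cx set \<Rightarrow> 'r NR cx set set" where
  "KM_proj X p = (\<lambda>g. act g p) ` Gamma_plus X"

definition KM :: "'r::finite K3 \<Rightarrow> 'r NR cx set set set" where
  "KM X = KM_proj X ` Dplus X"

definition standard_vec :: "'r::finite K3 \<Rightarrow> 'r NR \<Rightarrow> bool" where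
  "standard_vec X v \<longleftrightarrow> v \<in> int_triples \<and> N_pair X v v = 0 \<and>
     Gcd {k::int. \<exists>u\<in>int_triples. of_int k = N_pair X v u} = 1"

text \<open>A zero-dimensional boundary component of the Baily--Borel compactification is represented by
  the orbit of the line $\mathbb{Z}v$ to which it is attached.\<close>

definition cusp_of :: "'r::finite K3 \<Rightarrow> 'r NR \<Rightarrow> 'r NR set set" where
  "cusp_of X v = (\<lambda>g. g ` range (\<lambda>k::int. of_int k *\<^sub>R v)) ` Gamma_plus X"

definition standard_cusps :: "'r::finite K3 \<Rightarrow> 'r NR set set set" where
  "standard_cusps X = {cusp_of X v | v. standard_vec X v}"

text \<open>A path in \<open>KM X\<close> defined for $t \gg 0$ is given on \<open>{T<..}\<close>.\<close>

definition linear_degeneration ::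
  "'r::finite K3 \<Rightarrow> 'r NR set set \<Rightarrow> real \<Rightarrow> (real \<Rightarrow> 'r NR cx set set) \<Rightarrow> bool" where
  "linear_degeneration X \<kappa> T \<gamma> \<longleftrightarrow> 0 \<le> T \<and> (\<forall>t>T. \<gamma> t \<in> KM X) \<and>
     (\<exists>v w x\<^sub>0 y\<^sub>0. standard_vec X v \<and> \<kappa> = cusp_of X v \<and> w \<in> (\<lambda>g. g v) ` Gamma X \<and>
        x\<^sub>0 \<in> tube_A (N_pair X) w \<and> y\<^sub>0 \<in> tube_C (N_pair X) w \<and>
        (\<forall>t>T. exp_w (N_pair X) w x\<^sub>0 ((*\<^sub>R) t ` y\<^sub>0) \<in> Dplus X \<and>
               \<gamma> t = KM_proj X (exp_w (N_pair X) w x\<^sub>0 ((*\<^sub>R) t ` y\<^sub>0))))"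

definition KM_geodesic ::
  "'r::finite K3 \<Rightarrow> real set \<Rightarrow> (real \<Rightarrow> 'r NR cx set set) \<Rightarrow> bool" where
  "KM_geodesic X I \<gamma> \<longleftrightarrow>
     (\<exists>\<alpha>. geodesic_path (N_pair X) I \<alpha> \<and> (\<forall>t\<in>I. \<alpha> t \<in> Dplus X \<and> \<gamma> t = KM_proj X (\<alpha> t)))"

end

theory Submission
  imports Defs
begin

text \<open>In suitable representatives of the cosets, a linear degeneration to the cusp of an isotropic
  vector $w$ is $z(t) = (x - \frac12 t^2 y^2 w) + i t y$, where $x, w$ span a hyperbolic plane
  orthogonal to $y$; after $t = e^s$ it has constant speed. It is calibrated by the Busemann
  function $\ln (z.\bar z / |z.w|^2)$ of the cusp (up to an additive constant): along any curve,
  this function grows at a rate of at most a fixed multiple of the speed, by the Cauchy--Schwarz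
  inequality on the negative definite space $P^\perp$, and along the degeneration equality holds.
  So the degeneration even minimizes length globally.\<close>

section \<open>Traces of rank-one maps, spans of two vectors, derivatives of pairs\<close>

lemma cline_eqD:
  assumes "cline z = cline u"
  obtains c where "z = cx_scale c u"
proof -
  have "z = cx_scale 1 z" by (simp add: cx_scale_def)
  then have "z \<in> cline u" using assms unfolding cline_def by (metis rangeI)
  then show thesis using that unfolding cline_def by blast
qed

text \<open>Expand \<open>v\<close> in the orthonormal basis and use linearity of \<open>f\<close>.
  The square of \<open>skew x y p q\<close> is later written as a sum of such rank-one maps.\<close>

lemma lin_trace_rank_one:
  fixes f :: "'v::euclidean_space \<Rightarrow> real"
  assumes "linear f"
  shows "lin_trace (\<lambda>u. f u *\<^sub>R v) = f v"
proof -
  have "f v = f (\<Sum>e\<in>Basis. (v \<bullet> e) *\<^sub>R e)" by (simp add: euclidean_representation)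
  also have "\<dots> = (\<Sum>e\<in>Basis. (v \<bullet> e) * f e)"
    using assms by (simp add: linear_sum linear_cmul)
  finally show ?thesis by (simp add: lin_trace_def mult.commute)
qed

lemma lin_trace_add: "lin_trace (\<lambda>u. f u + g u) = lin_trace f + lin_trace g"
  by (simp add: lin_trace_def inner_add_left sum.distrib)

lemma span_pair: "u \<in> span {x, y} \<longleftrightarrow> (\<exists>k l. u = k *\<^sub>R x + l *\<^sub>R y)"
  by (simp add: span_breakdown_eq algebra_simps)

lemma has_vector_derivative_pair:
  assumes "(z has_vector_derivative z') F"
  shows "((\<lambda>t. fst (z t)) has_vector_derivative fst z') F"
    "((\<lambda>t. snd (z t)) has_vector_derivative snd z') F"
  using assms
  by (auto intro: bounded_linear.has_vector_derivative[OF bounded_linear_fst]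
      bounded_linear.has_vector_derivative[OF bounded_linear_snd])

section \<open>Velocities in the period domain\<close>

text \<open>Of a form of signature $(2, \rho)$, only the negative definiteness of the orthogonal
  complement of a positive plane is needed.\<close>

locale period_form =
  fixes b :: "'v::euclidean_space \<Rightarrow> 'v \<Rightarrow> real"
  assumes bilin: "bilinear b"
    and sym: "b x y = b y x"
    and neg: "\<lbrakk>0 < b x x; 0 < b y y; b x y = 0; b n x = 0; b n y = 0; n \<noteq> 0\<rbrakk> \<Longrightarrow> b n n < 0"
    and dim_gt: "2 < DIM('v)"
begin

lemmas bil = bilinear_ladd[OF bilin] bilinear_radd[OF bilin] bilinear_lmul[OF bilin]
  bilinear_rmul[OF bilin] bilinear_lneg[OF bilin] bilinear_rneg[OF bilin]
  bilinear_lsub[OF bilin] bilinear_rsub[OF bilin] bilinear_lzero[OF bilin] bilinear_rzero[OF bilin]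

section \<open>The cone, projection to $P^\<bottom>$, and the structure of $m_P$\<close>

lemma period_coneI:
  assumes "b x x = b y y" "b x y = 0" "0 < b x x"
  shows "(x, y) \<in> period_cone b"
proof -
  have "b y x = 0" using assms(2) sym[of y x] by simp
  then show ?thesis
    using assms by (simp add: period_cone_def cx_bil_def cx_conj_def complex_eq_iff bilinear_rneg[OF bilin])
qed

lemma period_coneD:
  assumes "(x, y) \<in> period_cone b"
  shows "b x x = b y y" "b x y = 0" "b y x = 0" "0 < b x x" "0 < b y y"
proof -
  have 1: "b x x - b y y = 0" "b x y + b y x = 0" "0 < b x x + b y y"
    using assms
    by (auto simp: period_cone_def cx_bil_def cx_conj_def complex_eq_iff bilinear_rneg[OF bilin])
  show "b x x = b y y" "b x y = 0" "b y x = 0" "0 < b x x" "0 < b y y"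
    using 1 sym[of x y] by linarith+
qed

lemma bil_span_pair: "b u x = 0 \<Longrightarrow> b u y = 0 \<Longrightarrow> v \<in> span {x, y} \<Longrightarrow> b u v = 0"
  by (auto simp: span_pair bil)

lemma pos_plane_pair: "pos_plane (x, y) = span {x, y}"
  by (simp add: pos_plane_def)

lemma orth_compl_pos_plane:
  "orth_compl b (pos_plane (x, y)) = {u. b u x = 0 \<and> b u y = 0}"
proof -
  have "(\<forall>p\<in>span {x, y}. b u p = 0) \<longleftrightarrow> b u x = 0 \<and> b u y = 0" for u
    using bil_span_pair[of u x y] span_base[of x "{x, y}"] span_base[of y "{x, y}"] by blast
  then show ?thesis unfolding orth_compl_def pos_plane_def by simp
qed

text \<open>For \<open>(x, y)\<close> in the cone, \<open>perp x y\<close> is the orthogonal projection to $P^\perp$, and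
  \<open>skew x y p q\<close> is the element of $\mathfrak{m}_P$ with $x \mapsto p$, $y \mapsto q$.\<close>

definition perp :: "'v \<Rightarrow> 'v \<Rightarrow> 'v \<Rightarrow> 'v" where
  "perp x y u = u - (b u x / b x x) *\<^sub>R x - (b u y / b x x) *\<^sub>R y"

definition skew :: "'v \<Rightarrow> 'v \<Rightarrow> 'v \<Rightarrow> 'v \<Rightarrow> 'v \<Rightarrow> 'v" where
  "skew x y p q u = (b u x / b x x) *\<^sub>R p + (b u y / b x x) *\<^sub>R q
     + (- b u p / b x x) *\<^sub>R x + (- b u q / b x x) *\<^sub>R y"

lemma perp_orth:
  assumes "(x, y) \<in> period_cone b"
  shows "b (perp x y u) x = 0" "b (perp x y u) y = 0"
  using period_coneD[OF assms] by (simp_all add: perp_def bil)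

text \<open>Pythagoras: \<open>x\<close> and \<open>y\<close> are orthogonal of equal square. The
  right-hand side is free of \<open>perp\<close>, which serves both the continuity and the explicit
  evaluation of \<open>energy\<close>.\<close>

lemma perp_square:
  assumes "(x, y) \<in> period_cone b"
  shows "b (perp x y u) (perp x y u) = b u u - ((b u x)\<^sup>2 + (b u y)\<^sup>2) / b x x"
  using period_coneD[OF assms] sym[of x u] sym[of y u]
  by (simp add: perp_def bil field_simps power2_eq_square)

lemma linear_skew: "linear (skew x y p q)"
  by (rule linearI) (simp_all add: skew_def bil algebra_simps add_divide_distrib diff_divide_distrib)

lemma skew_in_lie_m:
  assumes p: "b p x = 0" "b p y = 0" and q: "b q x = 0" "b q y = 0"
  shows "skew x y p q \<in> lie_m b (pos_plane (x, y))"
proof -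
  have "skew x y p q \<in> lie_so b"
  proof -
    have "b (skew x y p q u) v + b u (skew x y p q v) = 0" for u v
      by (simp add: skew_def bil sym[of p v] sym[of q v] sym[of x v] sym[of y v])
    then show ?thesis unfolding lie_so_def using linear_skew by blast
  qed
  moreover have "skew x y p q u \<in> orth_compl b (pos_plane (x, y))" if "u \<in> pos_plane (x, y)" for u
  proof -
    have "b p u = 0" "b q u = 0"
      using that bil_span_pair[OF p] bil_span_pair[OF q] by (auto simp: pos_plane_def)
    then show ?thesis
      using p q by (simp add: orth_compl_pos_plane skew_def bil sym[of u p] sym[of u q])
  qed
  moreover have "skew x y p q u \<in> pos_plane (x, y)" if "u \<in> orth_compl b (pos_plane (x, y))" for u
  proof -
    have "skew x y p q u = (- b u p / b x x) *\<^sub>R x + (- b u q / b x x) *\<^sub>R y"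
      using that by (simp add: orth_compl_pos_plane skew_def)
    then show ?thesis unfolding pos_plane_pair span_pair by blast
  qed
  ultimately show ?thesis unfolding lie_m_def by blast
qed

lemma skew_on_plane:
  assumes z: "(x, y) \<in> period_cone b"
    and p: "b p x = 0" "b p y = 0" and q: "b q x = 0" "b q y = 0"
  shows "skew x y p q x = p" "skew x y p q y = q"
  using period_coneD[OF z] p q by (simp_all add: skew_def sym[of x p] sym[of x q] sym[of y p] sym[of y q])

text \<open>An element of $m_P$ is determined by its values on $P$: it maps the orthogonal
  complement into $P$, and skew-symmetry forces the coordinates there.\<close>

lemma lie_m_eq_skew:
  assumes z: "(x, y) \<in> period_cone b" and S: "S \<in> lie_m b (pos_plane (x, y))"
  shows "S = skew x y (S x) (S y)"
proof
  fix u
  note zD = period_coneD[OF z]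
  let ?m = "b x x"
  have lin: "linear S" and sk: "\<And>u v. b (S u) v = - b u (S v)"
    using S by (auto simp: lie_m_def lie_so_def add_eq_0_iff2)
  have "perp x y u \<in> orth_compl b (pos_plane (x, y))"
    using perp_orth[OF z] by (simp add: orth_compl_pos_plane)
  then have "S (perp x y u) \<in> pos_plane (x, y)" using S unfolding lie_m_def by blast
  then obtain k l where kl: "S (perp x y u) = k *\<^sub>R x + l *\<^sub>R y"
    unfolding pos_plane_pair span_pair by auto
  have Sx: "b x (S x) = 0" "b y (S x) = 0" "b x (S y) = 0" "b y (S y) = 0"
  proof -
    have "S x \<in> orth_compl b (pos_plane (x, y))" "S y \<in> orth_compl b (pos_plane (x, y))"
      using S unfolding lie_m_def pos_plane_def by (auto intro: span_base)
    then show "b x (S x) = 0" "b y (S x) = 0" "b x (S y) = 0" "b y (S y) = 0"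
      by (simp_all add: orth_compl_pos_plane sym[of x "S x"] sym[of y "S x"]
          sym[of x "S y"] sym[of y "S y"])
  qed
  have "k * ?m = b (S (perp x y u)) x" "l * ?m = b (S (perp x y u)) y"
    unfolding kl using zD by (simp_all add: bil)
  then have "k * ?m = - b u (S x)" "l * ?m = - b u (S y)"
    unfolding sk using Sx by (simp_all add: perp_def bil)
  then have k: "k = - b u (S x) / ?m" and l: "l = - b u (S y) / ?m"
    using zD by (simp_all add: field_simps)
  have "u = perp x y u + (b u x / ?m) *\<^sub>R x + (b u y / ?m) *\<^sub>R y"
    by (simp add: perp_def)
  then have "S u = S (perp x y u + (b u x / ?m) *\<^sub>R x + (b u y / ?m) *\<^sub>R y)"
    by (rule arg_cong)
  also have "\<dots> = S (perp x y u) + (b u x / ?m) *\<^sub>R S x + (b u y / ?m) *\<^sub>R S y"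
    by (simp only: linear_add[OF lin] linear_cmul[OF lin])
  finally show "S u = skew x y (S x) (S y) u"
    unfolding kl k l skew_def by (simp add: algebra_simps)
qed

text \<open>Each of the four rank-one summands of the square of \<open>skew x y p q\<close> has as
  its trace its functional evaluated at its vector. The summands give $-p^2$ and $-q^2$, each twice,
  divided by $x^2$.\<close>

lemma killing_skew:
  assumes z: "(x, y) \<in> period_cone b"
    and p: "b p x = 0" "b p y = 0" and q: "b q x = 0" "b q y = 0"
  shows "killing (skew x y p q) (skew x y p q)
    = (real DIM('v) - 2) * (- 2 * (b p p + b q q) / b x x)"
proof -
  let ?S = "skew x y p q" and ?m = "b x x"
  have lin: "linear (\<lambda>u. b u v / ?m)" "linear (\<lambda>u. - b u v / ?m)" for v
    by (rule linearI; simp add: bil add_divide_distrib diff_divide_distrib)+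
  \<comment> \<open>Only the inner factor is expanded, so that the composite is visibly a sum of
    rank-one maps.\<close>
  have "?S \<circ> ?S = (\<lambda>u. (b u x / ?m) *\<^sub>R ?S p + (b u y / ?m) *\<^sub>R ?S q
     + (- b u p / ?m) *\<^sub>R ?S x + (- b u q / ?m) *\<^sub>R ?S y)"
    (is "_ = ?R")
  proof
    fix u
    have "(?S \<circ> ?S) u = ?S ((b u x / ?m) *\<^sub>R p + (b u y / ?m) *\<^sub>R q
     + (- b u p / ?m) *\<^sub>R x + (- b u q / ?m) *\<^sub>R y)"
      by (simp add: skew_def[of x y p q u])
    also have "\<dots> = ?R u"
      by (simp only: linear_add[OF linear_skew] linear_cmul[OF linear_skew])
    finally show "(?S \<circ> ?S) u = ?R u" .
  qed
  then have "lin_trace (?S \<circ> ?S) = b (?S p) x / ?m + b (?S q) y / ?m - b p p / ?m - b q q / ?m"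
    by (simp only: lin_trace_add lin_trace_rank_one[OF lin(1)] lin_trace_rank_one[OF lin(2)]
        skew_on_plane[OF z p q])
  moreover have "b (?S p) x = - b p p" "b (?S q) y = - b q q"
    using period_coneD[OF z] p q by (simp_all add: skew_def bil)
  ultimately have "lin_trace (?S \<circ> ?S) = - 2 * (b p p + b q q) / ?m"
    by (simp add: add_divide_distrib diff_divide_distrib distrib_left)
  then show ?thesis by (simp only: killing_def)
qed

section \<open>Tangent vectors of the cone, velocity and speed\<close>

text \<open>The linearization of the cone equations $x^2 = y^2$ and $x.y = 0$.\<close>

definition tangent :: "'v cx \<Rightarrow> 'v cx \<Rightarrow> bool" where
  "tangent z z' \<longleftrightarrow> b (fst z') (fst z) = b (snd z') (snd z)
     \<and> b (fst z') (snd z) = - b (snd z') (fst z)"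

text \<open>The squared speed, divided by $2\rho$.\<close>

definition energy :: "'v cx \<Rightarrow> 'v cx \<Rightarrow> real" where
  "energy z z' = - (b (perp (fst z) (snd z) (fst z')) (perp (fst z) (snd z) (fst z'))
       + b (perp (fst z) (snd z) (snd z')) (perp (fst z) (snd z) (snd z'))) / b (fst z) (fst z)"

text \<open>Tangency says exactly that the components in $P$ of $x'$ and $y'$ together form a
  complex multiple of $z$. So $z'$ agrees modulo that line with its projection to the orthogonal
  complement, and \<open>skew\<close> has these projections as values on $x$ and $y$.\<close>

lemma velocity_eq_skew:
  assumes z: "z t = (x, y)" "(x, y) \<in> period_cone b"
    and z': "vector_derivative z (at t) = (x', y')" and tan: "tangent (x, y) (x', y')"
  shows "velocity b z t = skew x y (perp x y x') (perp x y y')"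
  unfolding velocity_def z z'
proof (rule the_equality)
  let ?m = "b x x" and ?S = "skew x y (perp x y x') (perp x y y')"
  note P = perp_orth[OF z(2)] and zD = period_coneD[OF z(2)]
  have "cx_map ?S (x, y) = (perp x y x', perp x y y')"
    by (simp add: cx_map_def skew_on_plane[OF z(2) P P])
  then have "cx_map ?S (x, y) - (x', y') = cx_scale (Complex (- b x' x / ?m) (b x' y / ?m)) (x, y)"
    using tan by (simp add: cx_scale_def perp_def tangent_def)
  then show "?S \<in> lie_m b (pos_plane (x, y)) \<and> cx_map ?S (x, y) - (x', y') \<in> cline (x, y)"
    using skew_in_lie_m[OF P P] unfolding cline_def by blast
  fix S assume S: "S \<in> lie_m b (pos_plane (x, y)) \<and> cx_map S (x, y) - (x', y') \<in> cline (x, y)"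
  then obtain c where "S x - x' = Re c *\<^sub>R x - Im c *\<^sub>R y" "S y - y' = Re c *\<^sub>R y + Im c *\<^sub>R x"
    by (auto simp: cline_def cx_scale_def cx_map_def)
  then have c: "S x = x' + Re c *\<^sub>R x - Im c *\<^sub>R y" "S y = y' + Re c *\<^sub>R y + Im c *\<^sub>R x"
    by (simp_all add: algebra_simps)
  have "S x \<in> orth_compl b (pos_plane (x, y))" "S y \<in> orth_compl b (pos_plane (x, y))"
    using S unfolding lie_m_def pos_plane_def by (auto intro: span_base)
  then have "b (S x) x = 0" "b (S x) y = 0" "b (S y) x = 0" "b (S y) y = 0"
    by (simp_all add: orth_compl_pos_plane)
  \<comment> \<open>Since $Sx$ and $Sy$ are orthogonal to $P$, pairing them with $x$ and $y$
    determines the complex multiple \<open>c\<close>.\<close>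
  then have "Re c = - b x' x / ?m" "Im c = b x' y / ?m" "Im c = - b y' x / ?m" "Re c = - b y' y / ?m"
    using zD by (simp_all add: c bil field_simps)
  then have "S x = perp x y x'" "S y = perp x y y'"
    using c by (simp_all add: perp_def, metis add_uminus_conv_diff diff_add_eq scaleR_minus_left minus_divide_left)
  then show "S = ?S" using lie_m_eq_skew[OF z(2)] S by metis
qed

lemma riem_speed_eq:
  assumes "z t \<in> period_cone b" "tangent (z t) (vector_derivative z (at t))"
  shows "riem_speed b z t
    = sqrt (2 * (real DIM('v) - 2)) * sqrt (energy (z t) (vector_derivative z (at t)))"
proof -
  obtain x y x' y' where z: "z t = (x, y)" "vector_derivative z (at t) = (x', y')"
    by (meson surj_pair)
  have c: "(x, y) \<in> period_cone b" "tangent (x, y) (x', y')" using assms z by simp_all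
  show ?thesis
    unfolding riem_speed_def velocity_eq_skew[of z, OF z(1) c(1) z(2) c(2)]
      killing_skew[OF c(1) perp_orth[OF c(1)] perp_orth[OF c(1)]]
    unfolding z energy_def real_sqrt_mult[symmetric]
    by (simp add: algebra_simps)
qed

section \<open>Cauchy-Schwarz on the negative definite complement\<close>

lemma neg_perp:
  assumes "(x, y) \<in> period_cone b" "b n x = 0" "b n y = 0"
  shows "b n n \<le> 0" "b n n = 0 \<Longrightarrow> n = 0"
  using period_coneD[OF assms(1)] neg[of x y n] assms(2,3)
  by (cases "n = 0"; force simp: bil)+

text \<open>The component of \<open>p\<close> orthogonal to \<open>n\<close> has non-positive
  square; multiply by the negative number \<open>b n n\<close>.\<close>

lemma perp_Cauchy_Schwarz:
  assumes z: "(x, y) \<in> period_cone b"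
    and p: "b p x = 0" "b p y = 0" and n: "b n x = 0" "b n y = 0"
  shows "(b p n)\<^sup>2 \<le> b p p * b n n"
proof (cases "n = 0")
  case True
  then show ?thesis by (simp add: bil)
next
  case False
  then have nn: "b n n < 0" using neg_perp[OF z n] by force
  let ?k = "b p n / b n n"
  have "b (p - ?k *\<^sub>R n) (p - ?k *\<^sub>R n) \<le> 0"
    by (rule neg_perp(1)[OF z]) (simp_all add: bil p n)
  also have "b (p - ?k *\<^sub>R n) (p - ?k *\<^sub>R n) = b p p - (b p n)\<^sup>2 / b n n"
    using nn by (simp add: bil sym[of n p] field_simps power2_eq_square)
  finally show ?thesis using nn by (simp add: field_simps)
qed

section \<open>The Busemann function of a cusp\<close>

text \<open>On the cone, $z$ times its conjugate is $2 x^2$, so this is the logarithmic function of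
  the cusp minus \<open>ln 2\<close>. If $z.w = -1$, it is the logarithm of the square of the
  imaginary part.\<close>

definition busemann :: "'v \<Rightarrow> 'v cx \<Rightarrow> real" where
  "busemann w z = ln (b (fst z) (fst z)) - ln ((b (fst z) w)\<^sup>2 + (b (snd z) w)\<^sup>2)"

text \<open>Otherwise the nonzero isotropic vector \<open>w\<close> would lie in the negative
  definite complement of $P$.\<close>

lemma isotropic_pairing_pos:
  assumes z: "(x, y) \<in> period_cone b" and w: "w \<noteq> 0" "b w w = 0"
  shows "0 < (b x w)\<^sup>2 + (b y w)\<^sup>2"
proof (rule ccontr)
  assume "\<not> ?thesis"
  then have "b w x = 0" "b w y = 0" by (auto simp: sym[of w x] sym[of w y] sum_power2_gt_zero_iff)
  then show False using neg_perp(2)[OF z] w by blast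
qed

text \<open>Scaling by \<open>c\<close> multiplies both arguments of the logarithms by $|c|^2$, so
  the function descends to the period domain.\<close>

lemma busemann_cline:
  assumes z: "z \<in> period_cone b" and u: "u \<in> period_cone b" and w: "w \<noteq> 0" "b w w = 0"
    and eq: "cline z = cline u"
  shows "busemann w z = busemann w u"
proof -
  obtain x y where u_eq: "u = (x, y)" by (cases u)
  obtain c where c: "z = cx_scale c u" using cline_eqD[OF eq] .
  note uD = period_coneD[OF u[unfolded u_eq]]
  let ?k = "(Re c)\<^sup>2 + (Im c)\<^sup>2"
  have 1: "b (fst z) (fst z) = ?k * b x x"
    using uD by (simp add: c u_eq cx_scale_def bil power2_eq_square algebra_simps)
  have 2: "(b (fst z) w)\<^sup>2 + (b (snd z) w)\<^sup>2 = ?k * ((b x w)\<^sup>2 + (b y w)\<^sup>2)"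
    by (simp add: c u_eq cx_scale_def bil power2_eq_square algebra_simps)
  have "0 < b (fst z) (fst z)" using z period_coneD(4)[of "fst z" "snd z"] by simp
  then have k: "0 < ?k" using 1 uD by (simp add: zero_less_mult_iff)
  show ?thesis
    unfolding busemann_def 1 2 ln_mult_pos[OF k uD(4)]
      ln_mult_pos[OF k isotropic_pairing_pos[OF u[unfolded u_eq] w]]
    by (simp add: u_eq)
qed

text \<open>The derivative of \<open>busemann\<close> in the direction \<open>z'\<close>, written
  out so that its bound becomes a purely algebraic statement.\<close>

definition dbusemann :: "'v \<Rightarrow> 'v cx \<Rightarrow> 'v cx \<Rightarrow> real" where
  "dbusemann w z z' = 2 * b (fst z') (fst z) / b (fst z) (fst z)
     - 2 * (b (fst z) w * b (fst z') w + b (snd z) w * b (snd z') w)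
         / ((b (fst z) w)\<^sup>2 + (b (snd z) w)\<^sup>2)"

text \<open>Modulo $\mathbb{C}z$, $z'$ is $p + iq$, so the derivative is $-2\,\mathrm{Re}((p + iq).w / z.w)$; the
  component of $w$ in $P^\perp$ has square $-|z.w|^2 / x^2$.\<close>

lemma busemann_Lipschitz:
  assumes z: "(x, y) \<in> period_cone b" and w: "w \<noteq> 0" "b w w = 0"
    and tan: "tangent (x, y) (x', y')"
  shows "dbusemann w (x, y) (x', y') \<le> 2 * sqrt (energy (x, y) (x', y'))"
proof -
  note zD = period_coneD[OF z] and P = perp_orth[OF z]
  let ?m = "b x x" and ?p = "perp x y x'" and ?q = "perp x y y'" and ?n = "perp x y w"
  define \<alpha> \<beta> where "\<alpha> = b x w" and "\<beta> = b y w"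
  define N where "N = \<alpha>\<^sup>2 + \<beta>\<^sup>2"
  have N: "0 < N" using isotropic_pairing_pos[OF z w] by (simp add: N_def \<alpha>_def \<beta>_def)
  \<comment> \<open>Up to sign, \<open>?r\<close> and \<open>?s\<close> are the real and imaginary
    parts of $p + iq$ times the conjugate of $z.w$. Hence \<open>k / N\<close> is the real part of
    $(p + iq).w / z.w$.\<close>
  let ?r = "\<alpha> *\<^sub>R ?p + \<beta> *\<^sub>R ?q" and ?s = "\<beta> *\<^sub>R ?p - \<alpha> *\<^sub>R ?q"
  define k where "k = b ?r ?n"
  have pn: "b u ?n = b u w" if "b u x = 0" "b u y = 0" for u
    using that by (simp add: perp_def bil)
  have "b ?r x = 0" "b ?r y = 0" by (simp_all add: bil P)
  then have "k = b ?r w" unfolding k_def by (rule pn)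
  then have k1: "k = \<alpha> * b ?p w + \<beta> * b ?q w" by (simp add: bil)
  have "dbusemann w (x, y) (x', y') = - 2 * (k / N)"
  proof -
    have x': "b x' w = b ?p w + b x' x / ?m * \<alpha> + b x' y / ?m * \<beta>"
      and y': "b y' w = b ?q w + b y' x / ?m * \<alpha> + b y' y / ?m * \<beta>"
      by (simp_all add: perp_def bil \<alpha>_def \<beta>_def)
    \<comment> \<open>By tangency the mixed terms in \<open>\<alpha> * \<beta>\<close> cancel; the
      multiple of \<open>N\<close> that remains cancels the first summand of
      \<open>dbusemann\<close>.\<close>
    have eq: "\<alpha> * b x' w + \<beta> * b y' w = k + b x' x / ?m * N"
      using tan unfolding x' y' k1 N_def tangent_def
      by (simp add: algebra_simps power2_eq_square add_divide_distrib)
    show ?thesis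
      unfolding dbusemann_def fst_conv snd_conv \<alpha>_def[symmetric] \<beta>_def[symmetric]
        N_def[symmetric] eq
      using N zD by (simp add: field_simps)
  qed
  moreover have "(k / N)\<^sup>2 \<le> energy (x, y) (x', y')"
  proof -
    have n: "b ?n ?n = - N / ?m"
      using w by (simp add: perp_square[OF z] N_def \<alpha>_def \<beta>_def sym[of w x] sym[of w y]
          minus_divide_left)
    have "k\<^sup>2 \<le> b ?r ?r * b ?n ?n"
      unfolding k_def by (rule perp_Cauchy_Schwarz[OF z]) (simp_all add: bil P)
    also have "\<dots> = (- b ?r ?r) * (N / ?m)" by (simp add: n)
    also have "\<dots> \<le> (N * - (b ?p ?p + b ?q ?q)) * (N / ?m)"
    proof (rule mult_right_mono)
      \<comment> \<open>Dropping the imaginary part \<open>?s\<close> costs nothing in this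
        direction because its square is non-positive.\<close>
      have "b ?s ?s \<le> 0" by (rule neg_perp(1)[OF z]) (simp_all add: bil P)
      moreover have "b ?r ?r + b ?s ?s = N * (b ?p ?p + b ?q ?q)"
        by (simp add: bil N_def algebra_simps power2_eq_square)
      ultimately show "- b ?r ?r \<le> N * - (b ?p ?p + b ?q ?q)"
        unfolding mult_minus_right by linarith
    qed (use N zD in simp)
    also have "\<dots> = N\<^sup>2 * energy (x, y) (x', y')"
      by (simp add: energy_def power2_eq_square)
    finally show ?thesis using N by (simp add: power_divide divide_le_eq mult.commute)
  qed
  then have "\<bar>k / N\<bar> \<le> sqrt (energy (x, y) (x', y'))"
    by (metis real_sqrt_abs real_sqrt_le_iff)
  then have "- (k / N) \<le> sqrt (energy (x, y) (x', y'))" by (rule abs_le_D2)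
  ultimately show ?thesis by linarith
qed

section \<open>Differentiation along curves and the lower bound for lengths\<close>

lemma has_vector_derivative_b:
  assumes "(f has_vector_derivative f') (at t within I)" "(g has_vector_derivative g') (at t within I)"
  shows "((\<lambda>t. b (f t) (g t)) has_vector_derivative (b (f t) g' + b f' (g t))) (at t within I)"
  using bounded_bilinear.has_vector_derivative[OF bilin[unfolded bilinear_conv_bounded_bilinear]]
    assms by blast

lemma continuous_on_b [continuous_intros]:
  assumes "continuous_on I f" "continuous_on I g"
  shows "continuous_on I (\<lambda>t. b (f t) (g t))"
  using bounded_bilinear.continuous_on[OF bilin[unfolded bilinear_conv_bounded_bilinear]] assms .

text \<open>The closed interval is allowed because lifts are differentiable on both sides of its end
  points, although they may leave the cone there.\<close>

lemma period_cone_tangent: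
  fixes z :: "real \<Rightarrow> 'v cx"
  assumes d: "(z has_vector_derivative z') (at t)" and c: "\<And>t. t \<in> {p..q} \<Longrightarrow> z t \<in> period_cone b"
    and t: "t \<in> {p..q}" "p < q"
  shows "tangent (z t) z'"
proof -
  note d' = has_vector_derivative_pair[OF has_vector_derivative_at_within[OF d, of "{p..q}"]]
  have cD: "b (fst (z s)) (fst (z s)) - b (snd (z s)) (snd (z s)) = 0"
    "b (fst (z s)) (snd (z s)) = 0" if "s \<in> {p..q}" for s
    using period_coneD[of "fst (z s)" "snd (z s)"] c[OF that] by simp_all
  have nb: "at t within {p..q} \<noteq> bot"
    using t by (simp add: trivial_limit_within islimpt_Icc)
  \<comment> \<open>A function vanishing on the interval has derivative 0 even at an end point,
    since \<open>nb\<close> makes the derivative within the interval unique.\<close>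
  have 0: "k = 0" if "(f has_vector_derivative k) (at t within {p..q})" "\<And>s. s \<in> {p..q} \<Longrightarrow> f s = 0"
    for f :: "real \<Rightarrow> real" and k
  proof -
    have "(f has_vector_derivative 0) (at t within {p..q})"
      by (rule has_vector_derivative_transform[OF t(1) that(2) has_vector_derivative_const])
    then show ?thesis using vector_derivative_unique_within[OF nb that(1)] by simp
  qed
  have "b (fst (z t)) (fst z') + b (fst z') (fst (z t))
      - (b (snd (z t)) (snd z') + b (snd z') (snd (z t))) = 0"
    by (rule 0[OF has_vector_derivative_diff[OF has_vector_derivative_b[OF d'(1) d'(1)]
            has_vector_derivative_b[OF d'(2) d'(2)]] cD(1)])
  moreover have "b (fst (z t)) (snd z') + b (fst z') (snd (z t)) = 0"
    by (rule 0[OF has_vector_derivative_b[OF d'] cD(2)])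
  ultimately show ?thesis
    by (simp add: tangent_def sym[of "fst (z t)"] sym[of "snd (z t)"])
qed

lemma busemann_has_derivative:
  assumes d: "(z has_vector_derivative z') (at t within I)" and c: "z t \<in> period_cone b"
    and w: "w \<noteq> 0" "b w w = 0"
  shows "((\<lambda>t. busemann w (z t)) has_vector_derivative dbusemann w (z t) z') (at t within I)"
proof -
  note d' = has_vector_derivative_pair[OF d]
  let ?x = "\<lambda>t. fst (z t)" and ?y = "\<lambda>t. snd (z t)"
  have c': "(?x t, ?y t) \<in> period_cone b" using c by simp
  have 1: "((\<lambda>t. b (?x t) (?x t)) has_field_derivative 2 * b (fst z') (?x t)) (at t within I)"
    using has_vector_derivative_b[OF d'(1) d'(1)]
    by (simp add: has_real_derivative_iff_has_vector_derivative sym[of "?x t" "fst z'"])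
  have 2: "((\<lambda>t. b (?x t) w) has_field_derivative b (fst z') w) (at t within I)"
    "((\<lambda>t. b (?y t) w) has_field_derivative b (snd z') w) (at t within I)"
    using has_vector_derivative_b[OF d'(1) has_vector_derivative_const, of w]
      has_vector_derivative_b[OF d'(2) has_vector_derivative_const, of w]
    by (simp_all add: has_real_derivative_iff_has_vector_derivative bil)
  show ?thesis
    unfolding busemann_def dbusemann_def has_real_derivative_iff_has_vector_derivative[symmetric]
    by (rule derivative_eq_intros 1 2 period_coneD(4)[OF c'] isotropic_pairing_pos[OF c' w] refl)+
      (use period_coneD(4)[OF c'] isotropic_pairing_pos[OF c' w] in \<open>simp add: field_simps\<close>)
qed

text \<open>Integrate \<open>busemann_Lipschitz\<close> along the curve; the square root is the
  factor between \<open>riem_speed\<close> and the root of \<open>energy\<close>.\<close>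

lemma riem_length_ge_busemann:
  assumes lift: "C1_lift b {p..q} \<delta> y" and "p \<le> q" and w: "w \<noteq> 0" "b w w = 0"
  shows "sqrt (2 * (real DIM('v) - 2)) * (busemann w (y q) - busemann w (y p))
    \<le> 2 * riem_length b y p q"
proof (cases "p = q")
  case True
  then show ?thesis by (simp add: riem_length_def)
next
  case False
  \<comment> \<open>A nondegenerate interval is what \<open>period_cone_tangent\<close> requires,
    hence the separate case \<open>p = q\<close>.\<close>
  then have "p < q" using \<open>p \<le> q\<close> by simp
  let ?I = "{p..q}" and ?c = "sqrt (2 * (real DIM('v) - 2))"
  obtain D where D: "\<And>t. t \<in> ?I \<Longrightarrow> (y has_vector_derivative D t) (at t)" "continuous_on ?I D"
    using lift unfolding C1_lift_def C1_differentiable_on_def by blast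
  have c: "y t \<in> period_cone b" if "t \<in> ?I" for t using lift that unfolding C1_lift_def by blast
  have c': "(fst (y t), snd (y t)) \<in> period_cone b" if "t \<in> ?I" for t using c[OF that] by simp
  have tan: "tangent (y t) (D t)" if "t \<in> ?I" for t
    using period_cone_tangent[OF D(1) c that \<open>p < q\<close>] that by blast
  have speed: "riem_speed b y t = ?c * sqrt (energy (y t) (D t))" if "t \<in> ?I" for t
    using riem_speed_eq[of y t] c[OF that] tan[OF that] vector_derivative_at[OF D(1)[OF that]] by simp
  have cy: "continuous_on ?I y"
    by (meson D(1) continuous_at_imp_continuous_on has_vector_derivative_continuous)
  \<comment> \<open>Continuity of the energy makes the speed integrable, so that
    \<open>riem_length\<close> is a genuine integral and not a default value.\<close>
  have "continuous_on ?I (\<lambda>t. energy (y t) (D t))"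
  proof -
    let ?x = "\<lambda>t. fst (y t)" and ?y = "\<lambda>t. snd (y t)"
    let ?e = "\<lambda>t u. b u u - ((b u (?x t))\<^sup>2 + (b u (?y t))\<^sup>2) / b (?x t) (?x t)"
    have "continuous_on ?I (\<lambda>t. - (?e t (fst (D t)) + ?e t (snd (D t))) / b (?x t) (?x t))"
      using cy D(2) period_coneD(4)[OF c'] by (intro continuous_intros) force+
    then show ?thesis
      by (rule continuous_on_eq) (simp add: energy_def perp_square[OF c'])
  qed
  then have "continuous_on ?I (\<lambda>t. ?c * sqrt (energy (y t) (D t)))"
    by (intro continuous_intros)
  then have "continuous_on ?I (riem_speed b y)"
    by (rule continuous_on_eq) (simp add: speed)
  then have "(riem_speed b y has_integral riem_length b y p q) ?I"
    unfolding riem_length_def by (intro integrable_integral integrable_continuous_real)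
  then have 1: "((\<lambda>t. 2 * riem_speed b y t) has_integral 2 * riem_length b y p q) ?I"
    by (rule has_integral_mult_right)
  have "((\<lambda>t. dbusemann w (y t) (D t)) has_integral busemann w (y q) - busemann w (y p)) ?I"
    by (rule fundamental_theorem_of_calculus[OF \<open>p \<le> q\<close>
          busemann_has_derivative[OF has_vector_derivative_at_within[OF D(1)] c w]])
  then have 2: "((\<lambda>t. ?c * dbusemann w (y t) (D t)) has_integral
      ?c * (busemann w (y q) - busemann w (y p))) ?I"
    by (rule has_integral_mult_right)
  show ?thesis
  proof (rule has_integral_le[OF 2 1])
    fix t assume t: "t \<in> ?I"
    have "dbusemann w (y t) (D t) \<le> 2 * sqrt (energy (y t) (D t))"
      using busemann_Lipschitz[OF c'[OF t] w, of "fst (D t)" "snd (D t)"] tan[OF t] by simp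
    then have "?c * dbusemann w (y t) (D t) \<le> ?c * (2 * sqrt (energy (y t) (D t)))"
      using dim_gt by (intro mult_left_mono) auto
    then show "?c * dbusemann w (y t) (D t) \<le> 2 * riem_speed b y t"
      by (simp add: speed[OF t])
  qed
qed

section \<open>Linear degenerations in the tube model\<close>

text \<open>The coefficient of \<open>w\<close> gives the real part the square $t^2 y^2$ when $x$ is
  isotropic, $w$ is isotropic and $x.w = -1$.\<close>

definition tube_vec :: "'v \<Rightarrow> 'v \<Rightarrow> 'v \<Rightarrow> real \<Rightarrow> 'v cx" where
  "tube_vec w x y t = (x - (t\<^sup>2 * b y y / 2) *\<^sub>R w, t *\<^sub>R y)"

lemma tube_vec_in_period_cone:
  assumes "b w w = 0" "b x x = 0" "b x w = -1" "b y w = 0" "b x y = 0" "0 < b y y" "t \<noteq> 0"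
  shows "tube_vec w x y t \<in> period_cone b"
  unfolding tube_vec_def using assms sym[of w x] sym[of w y]
  by (intro period_coneI) (auto simp: bil field_simps power2_eq_square zero_less_mult_iff mult_less_0_iff linorder_neq_iff)

text \<open>Representatives can be moved along \<open>w\<close> until \<open>x\<close> is isotropic
  and orthogonal to \<open>y\<close>; the cone equations then leave only one vector in the
  prescribed cosets.\<close>

lemma exp_w_eq_tube_vec:
  assumes w: "b w w = 0" and x: "x\<^sub>0 \<in> tube_A b w" and y: "y\<^sub>0 \<in> tube_C b w"
  obtains x y where "b x x = 0" "b x w = -1" "b y w = 0" "b x y = 0" "0 < b y y"
    "\<And>t. t \<noteq> 0 \<Longrightarrow> exp_w b w x\<^sub>0 ((*\<^sub>R) t ` y\<^sub>0) = cline (tube_vec w x y t)"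
proof -
  obtain x1 where x1: "x\<^sub>0 = coset_of w x1" "b x1 w = -1" using x unfolding tube_A_def by blast
  obtain y1 where y1: "y\<^sub>0 = coset_of w y1" "b y1 w = 0" "0 < b y1 y1"
    using y unfolding tube_C_def by blast
  \<comment> \<open>As $x_1.w = -1$, adding $a w$ lowers the square of $x_1$ by $2a$, and adding $a
    w$ to $y_1$ lowers its pairing with the real part by $a$.\<close>
  define x where "x = x1 + (b x1 x1 / 2) *\<^sub>R w"
  define y where "y = y1 + b x1 y1 *\<^sub>R w"
  have x0: "\<exists>a. u = x + a *\<^sub>R w" if u: "u \<in> x\<^sub>0" for u
  proof -
    obtain a where "u = x1 + a *\<^sub>R w" using u unfolding x1 coset_of_def by blast
    then have "u = x + (a - b x1 x1 / 2) *\<^sub>R w" by (simp add: x_def algebra_simps)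
    then show ?thesis ..
  qed
  have x0': "x + a *\<^sub>R w \<in> x\<^sub>0" for a
    unfolding x1 coset_of_def x_def
    by (rule range_eqI[of _ _ "b x1 x1 / 2 + a"]) (simp add: algebra_simps)
  have y0: "\<exists>a. u = y + a *\<^sub>R w" if u: "u \<in> y\<^sub>0" for u
  proof -
    obtain a where "u = y1 + a *\<^sub>R w" using u unfolding y1 coset_of_def by blast
    then have "u = y + (a - b x1 y1) *\<^sub>R w" by (simp add: y_def algebra_simps)
    then show ?thesis ..
  qed
  have y0': "y \<in> y\<^sub>0" unfolding y1 coset_of_def y_def by blast
  have wx: "b w x1 = -1" "b w y1 = 0" using x1 y1 by (simp_all add: sym[of w x1] sym[of w y1])
  have b: "b x x = 0" "b x w = -1" "b y w = 0" "b x y = 0" "0 < b y y"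
    by (simp_all add: x_def y_def bil w x1 y1 wx)
  have wx': "b w x = -1" "b w y = 0" "b y x = 0" using b by (simp_all add: sym[of w x] sym[of w y] sym[of y x])
  show thesis
  proof (rule that[of x y, OF b])
    fix t :: real assume t: "t \<noteq> 0"
    show "exp_w b w x\<^sub>0 ((*\<^sub>R) t ` y\<^sub>0) = cline (tube_vec w x y t)"
      unfolding exp_w_def
    proof (rule arg_cong[where f = cline], rule the_equality)
      have "x - k *\<^sub>R w \<in> x\<^sub>0" for k using x0'[of "- k"] by simp
      then show "tube_vec w x y t \<in> period_cone b \<and> cx_bil b (tube_vec w x y t) (w, 0) = -1 \<and>
          fst (tube_vec w x y t) \<in> x\<^sub>0 \<and> snd (tube_vec w x y t) \<in> (*\<^sub>R) t ` y\<^sub>0"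
        using tube_vec_in_period_cone[OF w b t] y0'
        by (auto simp: tube_vec_def cx_bil_def bil b w complex_eq_iff)
    next
      fix z assume z: "z \<in> period_cone b \<and> cx_bil b z (w, 0) = -1 \<and>
          fst z \<in> x\<^sub>0 \<and> snd z \<in> (*\<^sub>R) t ` y\<^sub>0"
      obtain a where a: "fst z = x + a *\<^sub>R w" using x0 z by blast
      obtain c where c: "snd z = t *\<^sub>R (y + c *\<^sub>R w)" using y0 z by blast
      have zD: "b (fst z) (fst z) = b (snd z) (snd z)" "b (fst z) (snd z) = 0"
        using z period_coneD[of "fst z" "snd z"] by simp_all
      \<comment> \<open>Equality of the squares fixes \<open>a\<close>; orthogonality of real and
        imaginary part gives \<open>c = 0\<close>, as \<open>t\<close> is nonzero.\<close>
      have "a = - (t\<^sup>2 * b y y / 2)"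
        using zD(1) by (simp add: a c bil b w wx' power2_eq_square)
      moreover have "c = 0" using zD(2) t by (simp add: a c bil b w wx')
      ultimately show "z = tube_vec w x y t"
        using a c by (simp add: tube_vec_def prod_eq_iff)
    qed
  qed
qed

lemma geodesic_path_tube_vec:
  assumes w: "b w w = 0" and b: "b x x = 0" "b x w = -1" "b y w = 0" "b x y = 0" "0 < b y y"
    and T: "0 \<le> T"
  shows "geodesic_path b {T<..} (\<lambda>t. cline (tube_vec w x y t))"
proof -
  define z where "z s = tube_vec w x y (exp s)" for s
  let ?c = "\<lambda>s. cline (z s)" and ?J = "{s. T < exp s}" and ?v = "sqrt (2 * (real DIM('v) - 2))"
  define z' where "z' s = (- ((exp s)\<^sup>2 * b y y) *\<^sub>R w, exp s *\<^sub>R y)" for s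
  have w0: "w \<noteq> 0" using b(2) by (auto simp: bil)
  have wx: "b w x = -1" "b w y = 0" "b y x = 0" using b by (simp_all add: sym[of w x] sym[of w y] sym[of y x])
  have cone: "z s \<in> period_cone b" for s
    unfolding z_def using tube_vec_in_period_cone[OF w b] by simp
  have dz: "(z has_vector_derivative z' s) (at s)" for s
    unfolding z_def z'_def tube_vec_def
    by (auto intro!: derivative_eq_intros has_vector_derivative_Pair simp: power2_eq_square)
  have "continuous_on ?J z'" unfolding z'_def by (intro continuous_intros)
  then have lift: "C1_lift b ?J ?c z"
    unfolding C1_lift_def C1_differentiable_on_def using dz cone by blast
  have speed: "riem_speed b z s = ?v" for s
  proof -
    have zp: "(fst (z s), snd (z s)) \<in> period_cone b" using cone by simp
    have "tangent (z s) (z' s)"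
      by (simp add: tangent_def z_def z'_def tube_vec_def bil b w wx power2_eq_square)
    \<comment> \<open>The imaginary part of \<open>z' s\<close> lies in $P$ and contributes nothing;
      the real part is a multiple of \<open>w\<close>, whose projection supplies the whole
      energy.\<close>
    moreover have "energy (z s) (z' s) = 1"
      unfolding energy_def perp_square[OF zp] using b(5)
      by (simp add: z_def z'_def tube_vec_def bil b w wx less_imp_neq[OF b(5), symmetric]
          field_simps power2_eq_square)
    ultimately show ?thesis
      using riem_speed_eq[of z s] cone vector_derivative_at[OF dz] by simp
  qed
  have bus: "busemann w (z s) = 2 * s + ln (b y y)" for s
  proof -
    have "busemann w (z s) = ln ((exp s)\<^sup>2 * b y y)"
      by (simp add: busemann_def z_def tube_vec_def bil b w wx)
    also have "\<dots> = 2 * s + ln (b y y)"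
      using b(5) by (simp add: ln_mult ln_realpow)
    finally show ?thesis .
  qed
  \<comment> \<open>A competitor shares only the end points in projective space, which by
    \<open>busemann_cline\<close> fixes the values of \<open>busemann\<close> there.\<close>
  have minimal: "riem_length b z s u \<le> riem_length b k p q"
    if su: "s \<le> u" and pq: "p \<le> q" and k: "C1_lift b {p..q} \<delta> k" "\<delta> p = ?c s" "\<delta> q = ?c u"
    for s u \<delta> k p q
  proof -
    have kc: "k p \<in> period_cone b" "cline (k p) = ?c s" "k q \<in> period_cone b" "cline (k q) = ?c u"
      using k pq unfolding C1_lift_def by auto
    have "busemann w (k p) = 2 * s + ln (b y y)" "busemann w (k q) = 2 * u + ln (b y y)"
      using busemann_cline[OF kc(1) cone w0 w kc(2)] busemann_cline[OF kc(3) cone w0 w kc(4)] bus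
      by simp_all
    then have "?v * (2 * (u - s)) \<le> 2 * riem_length b k p q"
      using riem_length_ge_busemann[OF k(1) pq w0 w] by (simp add: algebra_simps)
    moreover have "2 * riem_length b z s u = ?v * (2 * (u - s))"
      using su speed by (simp add: riem_length_def cong: integral_cong)
    ultimately show ?thesis by linarith
  qed
  have "affine_geodesic b ?J ?c"
    unfolding affine_geodesic_def
  proof (intro conjI exI[of _ z] exI[of _ ?v])
    show "open ?J" by (intro open_Collect_less continuous_intros)
    show "is_interval ?J"
      unfolding is_interval_1 by (auto intro: less_le_trans)
    show "0 < ?v" using dim_gt by simp
    show "\<forall>t\<in>?J. \<exists>\<epsilon>>0. \<forall>s\<in>?J. \<forall>u\<in>?J. \<bar>s - t\<bar> < \<epsilon> \<and> \<bar>u - t\<bar> < \<epsilon> \<and> s \<le> u \<longrightarrow>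
           (\<forall>\<delta> y p q. p \<le> q \<and> C1_lift b {p..q} \<delta> y \<and> \<delta> p = ?c s \<and> \<delta> q = ?c u \<longrightarrow>
              riem_length b z s u \<le> riem_length b y p q)"
      \<comment> \<open>Minimality is global, so any radius would do.\<close>
      using minimal by (intro ballI exI[of _ 1]) auto
  qed (use lift speed in auto)
  moreover have "ln C1_differentiable_on {T<..}"
    unfolding C1_differentiable_on_def
  proof (intro exI[of _ inverse] conjI ballI)
    show "(ln has_vector_derivative inverse t) (at t)" if "t \<in> {T<..}" for t
      using that T DERIV_ln[of t] by (simp add: has_real_derivative_iff_has_vector_derivative)
    show "continuous_on {T<..} inverse" using T by (intro continuous_intros) auto
  qed
  moreover have "0 < deriv ln t" if "t \<in> {T<..}" for t :: real
    using that T DERIV_imp_deriv[OF DERIV_ln[of t]] by simp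
  moreover have "ln ` {T<..} = ?J"
  proof
    show "ln ` {T<..} \<subseteq> ?J" using T by auto
    show "?J \<subseteq> ln ` {T<..}"
    proof
      fix s assume "s \<in> ?J"
      then show "s \<in> ln ` {T<..}" by (intro image_eqI[of _ _ "exp s"]) auto
    qed
  qed
  moreover have "cline (tube_vec w x y t) = ?c (ln t)" if "t \<in> {T<..}" for t
    using that T by (simp add: z_def)
  ultimately show ?thesis unfolding geodesic_path_def by blast
qed

end

section \<open>The Mukai form\<close>

text \<open>Integral classes of $NS(X)$ are of type $(1,1)$ by assumption; the standard basis
  vectors are integral, and linearity extends the orthogonality to real classes.\<close>

lemma chern_orthogonal_H20:
  assumes X: "projective_K3 X" and \<sigma>: "\<sigma> \<in> H20 X"
  shows "ipair X (chern X u) (fst \<sigma>) = 0" "ipair X (chern X u) (snd \<sigma>) = 0"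
proof -
  have bi: "bilinear (ipair X)" and lin: "linear (chern X)"
    and im: "chern X ` int_vecs = {l \<in> int_vecs. (l, 0) \<in> H11 X}"
    using X by (auto simp: projective_K3_def)
  have ax: "ipair X (chern X (axis i 1)) (fst \<sigma>) = 0 \<and> ipair X (chern X (axis i 1)) (snd \<sigma>) = 0" for i
  proof -
    have "(axis i 1 :: real^'a) \<in> int_vecs" by (simp add: int_vecs_def axis_def)
    then have "(chern X (axis i 1), 0) \<in> H11 X" using im by blast
    then have "cx_bil (ipair X) (chern X (axis i 1), 0) \<sigma> = 0" using \<sigma> by (auto simp: H11_def)
    then show ?thesis by (simp add: cx_bil_def complex_eq_iff bilinear_lzero[OF bi])
  qed
  have "linear (\<lambda>u. ipair X (chern X u) v)" for v
    using linear_compose[OF lin, of "\<lambda>x. ipair X x v"] bi by (auto simp: bilinear_def o_def)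
  then have 0: "ipair X (chern X u) v = 0" if "\<And>i. ipair X (chern X (axis i 1)) v = 0" for v
  proof (rule linear_eq_0_on_span[of _ Basis])
    show "ipair X (chern X e) v = 0" if "e \<in> Basis" for e
      using that \<open>\<And>i. ipair X (chern X (axis i 1)) v = 0\<close> by (auto simp: Basis_vec_def)
  qed simp_all
  show "ipair X (chern X u) (fst \<sigma>) = 0" "ipair X (chern X u) (snd \<sigma>) = 0"
    using ax 0 by blast+
qed

lemma bilinear_mukai:
  assumes "bilinear b"
  shows "bilinear (mukai b)"
  unfolding bilinear_def
  by (intro conjI allI linearI)
    (auto simp: mukai_def bilinear_ladd[OF assms] bilinear_radd[OF assms] bilinear_lmul[OF assms]
      bilinear_rmul[OF assms] algebra_simps)

lemma H_pair_N_incl: "H_pair X (N_incl X u) (N_incl X v) = N_pair X u v"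
  by (simp add: N_incl_def mukai_def ns_pair_def split: prod.splits)

text \<open>The two subspaces meet only in 0, since a common nonzero vector would have a square of
  both signs.\<close>

lemma dim_nonneg_add_dim_neg_le:
  fixes b :: "'v::euclidean_space \<Rightarrow> 'v \<Rightarrow> real"
  assumes W: "subspace W" "\<And>x. x \<in> W \<Longrightarrow> 0 \<le> b x x"
    and Q: "subspace Q" "\<And>x. x \<in> Q \<Longrightarrow> x \<noteq> 0 \<Longrightarrow> b x x < 0"
  shows "dim W + dim Q \<le> DIM('v)"
proof -
  have "W \<inter> Q \<subseteq> {0}" using W(2) Q(2) by force
  then have "dim (W \<inter> Q) = 0" by simp
  then have "dim W + dim Q = dim {x + y |x y. x \<in> W \<and> y \<in> Q}"
    using dim_sums_Int[OF W(1) Q(1)] by linarith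
  then show ?thesis using dim_subset_UNIV[of "{x + y |x y. x \<in> W \<and> y \<in> Q}"] by linarith
qed

text \<open>A nonzero vector of non-negative square in $N_{\mathbb{R}}$ orthogonal to a positive plane would span, together
  with this plane and the real and imaginary parts of $\sigma$, a $5$-dimensional semidefinite
  subspace of the full Mukai space, which has signature $(4, 20)$.\<close>

lemma period_form_N_pair:
  fixes X :: "'r::finite K3"
  assumes X: "projective_K3 X"
  shows "period_form (N_pair X)"
proof -
  have bi: "bilinear (ipair X)" and sy: "\<And>x y. ipair X x y = ipair X y x"
    and sg: "has_signature (ipair X) 3 19"
    and lin: "linear (chern X)" and inj: "inj (chern X)"
    using X unfolding projective_K3_def by blast+
  obtain s1 s2 where \<sigma>: "(s1, s2) \<in> H20 X"
    and s: "cx_bil (ipair X) (s1, s2) (s1, s2) = 0"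
      "0 < Re (cx_bil (ipair X) (s1, s2) (cx_conj (s1, s2)))"
  proof -
    obtain \<sigma> where *: "H20 X = cline \<sigma>" "cx_bil (ipair X) \<sigma> \<sigma> = 0"
      "0 < Re (cx_bil (ipair X) \<sigma> (cx_conj \<sigma>))"
      using X unfolding projective_K3_def by blast
    have "\<sigma> = cx_scale 1 \<sigma>" by (simp add: cx_scale_def)
    then have "\<sigma> \<in> H20 X" unfolding *(1) cline_def by (rule range_eqI)
    then show thesis using that[of "fst \<sigma>" "snd \<sigma>"] * by simp
  qed
  have ss: "ipair X s1 s2 = 0" "ipair X s2 s1 = 0" "0 < ipair X s1 s1" "0 < ipair X s2 s2"
    using s sy[of s1 s2]
    by (auto simp: cx_bil_def cx_conj_def complex_eq_iff bilinear_rneg[OF bi])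
  obtain Q where Q: "subspace Q" "dim Q = 19" "\<And>x. x \<in> Q \<Longrightarrow> x \<noteq> 0 \<Longrightarrow> ipair X x x < 0"
    using sg unfolding has_signature_def by blast
  \<comment> \<open>The vectors $(r, 0, r)$ have square $-2r^2$ and are orthogonal to $H^2$;
    together with \<open>Q\<close> they form a negative definite subspace of dimension 20.\<close>
  define h :: "real \<times> (real^22) \<Rightarrow> HR" where "h u = (fst u, snd u, fst u)" for u
  have lin_h: "linear h" by (rule linearI) (simp_all add: h_def)
  have inj_h: "inj h" by (rule injI) (simp add: h_def prod_eq_iff)
  define Q' where "Q' = h ` (UNIV \<times> Q)"
  have Q': "subspace Q'" "dim Q' = 20"
  proof -
    show "subspace Q'"
      unfolding Q'_def by (intro linear_subspace_image lin_h subspace_Times subspace_UNIV Q(1))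
    have "dim Q' = dim (UNIV \<times> Q :: (real \<times> (real^22)) set)"
      unfolding Q'_def by (rule dim_image_eq[OF lin_h]) (rule inj_on_subset[OF inj_h], simp)
    then show "dim Q' = 20" using Q by (simp add: dim_Times)
  qed
  have Q'_neg: "H_pair X u u < 0" if u: "u \<in> Q'" "u \<noteq> 0" for u
  proof -
    obtain r l where rl: "u = (r, l, r)" "l \<in> Q" using u(1) by (auto simp: Q'_def h_def)
    then have 1: "H_pair X u u = ipair X l l - 2 * r\<^sup>2" by (simp add: mukai_def power2_eq_square)
    show ?thesis
    proof (cases "l = 0")
      case True
      then have "r \<noteq> 0" using u(2) rl by (auto simp: zero_prod_def)
      then show ?thesis using 1 True by (simp add: bilinear_lzero[OF bi])
    next
      case False
      then have "ipair X l l < 0" using Q(3) rl by blast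
      then show ?thesis using 1 zero_le_power2[of r] by linarith
    qed
  qed
  have biH: "bilinear (H_pair X)" by (rule bilinear_mukai[OF bi])
  note bilH = bilinear_ladd[OF biH] bilinear_radd[OF biH] bilinear_lmul[OF biH] bilinear_rmul[OF biH]
  have syH: "H_pair X u v = H_pair X v u" for u v
    using sy[of "fst (snd u)" "fst (snd v)"] by (simp add: mukai_def case_prod_unfold algebra_simps)
  define S1 S2 :: HR where "S1 = (0, s1, 0)" and "S2 = (0, s2, 0)"
  have N0: "H_pair X (N_incl X u) S1 = 0" "H_pair X (N_incl X u) S2 = 0" for u
    using chern_orthogonal_H20[OF X \<sigma>]
    by (simp_all add: S1_def S2_def mukai_def N_incl_def split: prod.splits)
  have st: "H_pair X S1 S2 = 0" "H_pair X S2 S1 = 0" "0 < H_pair X S1 S1" "0 < H_pair X S2 S2"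
    using ss by (simp_all add: S1_def S2_def mukai_def)
  show ?thesis
  proof
    show "bilinear (N_pair X)"
    proof (rule bilinear_mukai)
      show "bilinear (ns_pair X)"
        unfolding bilinear_def ns_pair_def
        by (intro conjI allI linearI)
          (simp_all add: linear_add[OF lin] linear_cmul[OF lin] bilinear_ladd[OF bi]
            bilinear_radd[OF bi] bilinear_lmul[OF bi] bilinear_rmul[OF bi])
    qed
    show "N_pair X x y = N_pair X y x" for x y
      using syH[of "N_incl X x" "N_incl X y"] unfolding H_pair_N_incl .
    show "2 < DIM('r NR)" by simp
    fix x y n :: "'r NR"
    assume xy: "0 < N_pair X x x" "0 < N_pair X y y" "N_pair X x y = 0"
      and n: "N_pair X n x = 0" "N_pair X n y = 0" "n \<noteq> 0"
    show "N_pair X n n < 0"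
    proof (rule ccontr)
      assume nn: "\<not> ?thesis"
      let ?x = "N_incl X x" and ?y = "N_incl X y" and ?n = "N_incl X n"
      let ?b = "H_pair X"
      have n0: "?n \<noteq> 0"
      proof -
        obtain r l s where n_eq: "n = (r, l, s)" by (cases n)
        have "l = 0" if "chern X l = 0"
          using that inj unfolding linear_injective_0[OF lin] by blast
        then show ?thesis using n(3) by (auto simp: N_incl_def n_eq zero_prod_def)
      qed
      have pos: "0 < ?b ?x ?x" "0 < ?b ?y ?y" "0 \<le> ?b ?n ?n"
        using xy nn by (simp_all add: H_pair_N_incl)
      have orth: "?b ?x ?y = 0" "?b ?n ?x = 0" "?b ?n ?y = 0"
        using xy n by (simp_all add: H_pair_N_incl)
      have orth': "?b ?y ?x = 0" "?b ?x ?n = 0" "?b ?y ?n = 0"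
        "?b S1 (N_incl X u) = 0" "?b S2 (N_incl X u) = 0" for u
        using orth N0 syH by metis+
      define f :: "real \<times> real \<times> real \<times> real \<times> real \<Rightarrow> HR" where
        "f = (\<lambda>(c1, c2, c3, c4, c5). c1 *\<^sub>R ?x + c2 *\<^sub>R ?y + c3 *\<^sub>R ?n + c4 *\<^sub>R S1 + c5 *\<^sub>R S2)"
      have lin_f: "linear f"
        unfolding f_def by (rule linearI) (auto simp: scaleR_add_left scaleR_add_right)
      have f_sq: "?b (f (c1, c2, c3, c4, c5)) (f (c1, c2, c3, c4, c5)) =
          c1\<^sup>2 * ?b ?x ?x + c2\<^sup>2 * ?b ?y ?y + c3\<^sup>2 * ?b ?n ?n + c4\<^sup>2 * ?b S1 S1 + c5\<^sup>2 * ?b S2 S2"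
        for c1 c2 c3 c4 c5
        by (simp only: f_def prod.case bilH orth orth' N0 st) (simp add: power2_eq_square)
      have "inj f"
        unfolding linear_injective_0[OF lin_f]
      proof (clarify)
        fix c1 c2 c3 c4 c5
        assume f0: "f (c1, c2, c3, c4, c5) = 0"
        have "?b (f (c1, c2, c3, c4, c5)) v = 0" for v
          unfolding f0 by (rule bilinear_lzero[OF biH])
        \<comment> \<open>Pairing isolates every coefficient except \<open>c3\<close>, as
          \<open>?n\<close> may be isotropic; \<open>c3\<close> then vanishes because
          \<open>?n\<close> is nonzero.\<close>
        from this[of ?x] this[of ?y] this[of S1] this[of S2]
        have "c1 * ?b ?x ?x = 0" "c2 * ?b ?y ?y = 0" "c4 * ?b S1 S1 = 0" "c5 * ?b S2 S2 = 0"
          by (simp_all only: f_def prod.case bilH orth orth' N0 st real_scaleR_def mult_zero_right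
              add_0_left add_0_right)
        then have 0: "c1 = 0" "c2 = 0" "c4 = 0" "c5 = 0" using pos st by auto
        then have "c3 = 0" using f0 n0 by (simp add: f_def)
        with 0 show "(c1, c2, c3, c4, c5) = 0" by (simp add: zero_prod_def)
      qed
      then have "dim (range f) = DIM(real \<times> real \<times> real \<times> real \<times> real)"
        using dim_image_eq[OF lin_f, of UNIV] by simp
      moreover have "dim (range f) + dim Q' \<le> DIM(HR)"
      proof (rule dim_nonneg_add_dim_neg_le[where b = ?b, OF _ _ Q'(1) Q'_neg])
        show "subspace (range f)" by (rule linear_subspace_image[OF lin_f subspace_UNIV])
        fix u assume "u \<in> range f"
        then obtain c where "u = f c" by blast
        moreover obtain c1 c2 c3 c4 c5 where "c = (c1, c2, c3, c4, c5)" by (rule prod_cases5)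
        ultimately show "0 \<le> ?b u u"
          by (simp only: f_sq) (intro add_nonneg_nonneg mult_nonneg_nonneg zero_le_power2
              pos(3) less_imp_le[OF pos(1)] less_imp_le[OF pos(2)] less_imp_le[OF st(3)]
              less_imp_le[OF st(4)])
      qed
      \<comment> \<open>The dimensions 5 and 20 exceed the total 24.\<close>
      ultimately show False using Q'(2) by simp
    qed
  qed
qed

section \<open>Passage from the cusp to the tube model\<close>

text \<open>An element of \<open>Gamma X\<close> is induced by an isometry of the full Mukai space
  through \<open>N_incl\<close>, which preserves the pairings. This transfers isotropy from
  \<open>v\<close> to \<open>w\<close>.\<close>

lemma Gamma_preserves_N_pair:
  assumes "g \<in> Gamma X"
  shows "N_pair X (g u) (g v) = N_pair X u v"
proof -
  obtain \<phi> where h: "\<phi> \<in> hodge_isometries X" and g: "\<And>u. N_incl X (g u) = \<phi> (N_incl X u)"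
    using assms unfolding Gamma_def by blast
  have \<phi>: "H_pair X (\<phi> u) (\<phi> v) = H_pair X u v" for u v
    using h unfolding hodge_isometries_def by blast
  show ?thesis by (simp only: H_pair_N_incl[symmetric] g \<phi>)
qed

theorem corollary5p9:
  fixes X :: "'r::finite K3"
    and \<kappa> :: "'r NR set set"
    and T :: real
    and \<gamma> :: "real \<Rightarrow> 'r NR cx set set"
  assumes "projective_K3 X"
    and "\<kappa> \<in> standard_cusps X"
    and "linear_degeneration X \<kappa> T \<gamma>"
  shows "KM_geodesic X {T<..} \<gamma>"
proof -
  interpret period_form "N_pair X" by (rule period_form_N_pair[OF assms(1)])
  obtain v w x\<^sub>0 y\<^sub>0 where v: "standard_vec X v" and w: "w \<in> (\<lambda>g. g v) ` Gamma X"
    and x: "x\<^sub>0 \<in> tube_A (N_pair X) w" and y: "y\<^sub>0 \<in> tube_C (N_pair X) w"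
    and \<gamma>: "\<And>t. T < t \<Longrightarrow> exp_w (N_pair X) w x\<^sub>0 ((*\<^sub>R) t ` y\<^sub>0) \<in> Dplus X \<and>
               \<gamma> t = KM_proj X (exp_w (N_pair X) w x\<^sub>0 ((*\<^sub>R) t ` y\<^sub>0))"
    and T: "0 \<le> T"
    using assms(3) unfolding linear_degeneration_def by blast
  obtain g where g: "g \<in> Gamma X" "w = g v" using w by blast
  have w0: "N_pair X w w = 0"
    using v Gamma_preserves_N_pair[OF g(1), of v v] unfolding g(2) standard_vec_def by simp
  obtain x y where xy: "N_pair X x x = 0" "N_pair X x w = -1" "N_pair X y w = 0"
      "N_pair X x y = 0" "0 < N_pair X y y"
    and e: "\<And>t. t \<noteq> 0 \<Longrightarrow>
      exp_w (N_pair X) w x\<^sub>0 ((*\<^sub>R) t ` y\<^sub>0) = cline (tube_vec w x y t)"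
    using exp_w_eq_tube_vec[OF w0 x y] by blast
  have "cline (tube_vec w x y t) \<in> Dplus X \<and> \<gamma> t = KM_proj X (cline (tube_vec w x y t))"
    if "t \<in> {T<..}" for t
    \<comment> \<open>From \<open>0 \<le> T\<close> it follows that \<open>t\<close> is nonzero, as
      \<open>e\<close> demands.\<close>
    using \<gamma>[of t] e[of t] that T by simp
  then show ?thesis
    unfolding KM_geodesic_def using geodesic_path_tube_vec[OF w0 xy T] by blast
qed

end
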